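(* Let $(T,X,\mu)$ be an ergodic measure-preserving map $T:X\to X$ of a probability space $(X,\mu)$ which is also a metric space with metric $d$. Suppose that: (A, with exponential rate) there are constants $C>0$, $0<\alpha<1$ and a rate function $p(k)\le C\alpha^k$ such that for all Lipschitz functions $\phi,\psi$ on $X$ and all $k\ge1$, $$|E(\phi\cdot\psi\circ T^k)-E(\phi)E(\psi)|\le p(k)\,\|\phi\|_{\mathrm{Lip}}\,\|\psi\|_{\mathrm{Lip}};$$ (B) there exist $r_0>0$ and $0<\delta<1$ such that for all $z\in X$ and all $0<\epsilon<r\le r_0$, $$\mu\{x: r<d(x,z)<r+\epsilon\}<\epsilon^{\delta}.$$ Let $(B_i)_{i\ge1}$ be a sequence of balls $B_i=B(p_i,r_i)$ in $X$ with $\mu(B_i)\ge\frac{\log i}{i}$ for all $i\ge1$. Then $$\lim_{n\to\infty}\frac{S_n(x)}{E_n}=1\quad\text{for }\mu\text{-a.e. }x\in X,$$ where $S_n(x)=\sum_{k=1}^{n}1_{B_k}(T^kx)$ and $E_n=\sum_{k=1}^{n}\mu(B_k)$.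
   Context: $E(\phi)=\int_X\phi\,d\mu$. $1_A$ is the indicator function of $A$. $B(p,r)=\{x\in X:d(x,p)<r\}$ is the ball of radius $r$ about $p$; the centres $p_i$ may vary with $i$ and the balls need not be nested. $\|\cdot\|_{\mathrm{Lip}}$ is the usual Lipschitz norm (sup norm plus Lipschitz constant), and "Lipschitz function" means one with finite norm. Balls are assumed measurable. The rate function $p$ and the constants $C,\alpha$ do not depend on $\phi,\psi$.
   Formalization: The formal theorem additionally assumes that r_i ≤ r_0 for all sufficiently large i; without this the statement is false, since condition (B) says nothing about balls of radius larger than r_0. Lipschitz functions in (A) are taken to be measurable. *)

theory Defs
  imports "HOL-Probability.Probability"
begin

definition measure_preserving :: "'a measure \<Rightarrow> ('a \<Rightarrow> 'a) \<Rightarrow> bool" where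
  "measure_preserving M T \<longleftrightarrow> T \<in> measurable M M \<and>
     (\<forall>A\<in>sets M. emeasure M (T -` A \<inter> space M) = emeasure M A)"

definition ergodic :: "'a measure \<Rightarrow> ('a \<Rightarrow> 'a) \<Rightarrow> bool" where
  "ergodic M T \<longleftrightarrow> measure_preserving M T \<and>
     (\<forall>A\<in>sets M. T -` A \<inter> space M = A \<longrightarrow> measure M A = 0 \<or> measure M A = 1)"

text \<open>
  The measurable functions of finite Lipschitz norm. Only balls are assumed to be measurable, so
  measurability of a Lipschitz function is not automatic on a nonseparable space; without it the
  expectations in the decay of correlations would have no meaning.
\<close>

definition lipschitz_observable :: "'a::metric_space measure \<Rightarrow> ('a \<Rightarrow> real) \<Rightarrow> bool" where
  "lipschitz_observable M \<phi> \<longleftrightarrow>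
     \<phi> \<in> borel_measurable M \<and> bounded (range \<phi>) \<and> (\<exists>L. L-lipschitz_on UNIV \<phi>)"

definition lip_const :: "('a::metric_space \<Rightarrow> real) \<Rightarrow> real" where
  "lip_const \<phi> = Inf {L. L-lipschitz_on UNIV \<phi>}"

text \<open>Meaningful only for bounded Lipschitz functions; elsewhere \<open>SUP\<close> and \<open>Inf\<close> are unspecified.\<close>

definition lip_norm :: "('a::metric_space \<Rightarrow> real) \<Rightarrow> real" where
  "lip_norm \<phi> = (SUP x. \<bar>\<phi> x\<bar>) + lip_const \<phi>"

end

(*
  For i < j, replace the indicators of B_i and B_j by Lipschitz functions that exceed them only on
  annuli of width about j^(-b). By (B) this costs O(j^(-2)) in expectation, and the Lipschitz norms
  are O(j^b), so by (A) the events T^(-i) B_i and T^(-j) B_j have covariance O(j^(-2)) as soon as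
  j - i >= kappa ln j; nearer pairs have covariance at most mu(B_j). Hence
  Var S_n = O((1 + ln n) E_n). The hypothesis mu(B_i) >= ln i / i gives (ln n)^2 = O(E_n), so
  Var S_n = O(E_n^(3/2)). Along n_k with E_n about k^4, Chebyshev and Borel-Cantelli give
  S_n / E_n -> 1 almost surely, and monotonicity of S and E fills the gaps because
  E_(n_(k+1)) / E_(n_k) -> 1.

  The annuli must be thin compared with r_j. Condition (B) makes mu(B(p, s)) = O(s^delta), and thus
  r_i at least a power of 1/i, except when p is isolated at distance more than r0 from every other
  point; then B_i is the single point p and its indicator is itself Lipschitz.
*)
theory Submission
  imports Defs "HOL-Real_Asymp.Real_Asymp"
begin

section \<open>Lipschitz cutoff functions\<close>

lemma lip_norm_le:
  assumes "L-lipschitz_on UNIV f" and "\<And>x. \<bar>f x\<bar> \<le> b"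
  shows "lip_norm f \<le> b + L"
proof -
  have "(SUP x. \<bar>f x\<bar>) \<le> b"
    by (rule cSUP_least) (use assms in auto)
  moreover have "lip_const f \<le> L"
    unfolding lip_const_def
    by (rule cInf_lower) (use assms in \<open>auto intro!: bdd_belowI[of _ 0] dest: lipschitz_on_nonneg\<close>)
  ultimately show ?thesis
    unfolding lip_norm_def by linarith
qed

lemma lip_norm_nonneg:
  assumes "lipschitz_observable M f"
  shows "lip_norm f \<ge> 0"
proof -
  have "bdd_above (range (\<lambda>x. \<bar>f x\<bar>))"
    using assms unfolding lipschitz_observable_def bounded_iff bdd_above_def by auto
  \<comment> \<open>Any point would serve: the supremum dominates one nonnegative value.\<close>
  then have "\<bar>f undefined\<bar> \<le> (SUP x. \<bar>f x\<bar>)"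
    by (intro cSUP_upper) auto
  moreover have "lip_const f \<ge> 0"
    unfolding lip_const_def
    by (rule cInf_greatest) (use assms in \<open>auto simp: lipschitz_observable_def dest: lipschitz_on_nonneg\<close>)
  ultimately show ?thesis
    unfolding lip_norm_def by linarith
qed

text \<open>A Lipschitz substitute for the indicator of a ball: 1 up to radius s, then linear down
  to 0 at radius s + \<epsilon>. The slope 1/\<epsilon> is the price of confining the error to an
  annulus of width \<epsilon>.\<close>

definition cutoff :: "'a::metric_space \<Rightarrow> real \<Rightarrow> real \<Rightarrow> 'a \<Rightarrow> real" where
  "cutoff z s \<epsilon> x = max 0 (min 1 (1 - (dist x z - s) / \<epsilon>))"

lemma cutoff_nonneg: "cutoff z s \<epsilon> x \<ge> 0"
  and cutoff_le_1: "cutoff z s \<epsilon> x \<le> 1"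
  by (auto simp: cutoff_def)

lemma cutoff_eq_1: "dist x z \<le> s \<Longrightarrow> \<epsilon> > 0 \<Longrightarrow> cutoff z s \<epsilon> x = 1"
  by (auto simp: cutoff_def divide_simps)

lemma cutoff_eq_0: "dist x z \<ge> s + \<epsilon> \<Longrightarrow> \<epsilon> > 0 \<Longrightarrow> cutoff z s \<epsilon> x = 0"
  by (auto simp: cutoff_def field_simps)

lemma lipschitz_on_cutoff:
  assumes "\<epsilon> > 0"
  shows "(1 / \<epsilon>)-lipschitz_on U (cutoff z s \<epsilon>)"
proof (rule lipschitz_onI)
  fix x y
  \<comment> \<open>Clamping to [0, 1] does not increase distances.\<close>
  have "\<bar>cutoff z s \<epsilon> x - cutoff z s \<epsilon> y\<bar> \<le> \<bar>(dist x z - s) / \<epsilon> - (dist y z - s) / \<epsilon>\<bar>"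
    unfolding cutoff_def by linarith
  also have "\<dots> = \<bar>dist x z - dist y z\<bar> / \<epsilon>"
    using assms by (simp add: diff_divide_distrib[symmetric])
  also have "\<dots> \<le> dist x y / \<epsilon>"
    using assms abs_dist_diff_le[of x z y] by (intro divide_right_mono) (auto simp: dist_commute)
  finally show "dist (cutoff z s \<epsilon> x) (cutoff z s \<epsilon> y) \<le> 1 / \<epsilon> * dist x y"
    by (simp add: dist_real_def)
qed (use assms in auto)

text \<open>The strict sublevel sets of the distance to z are balls about z. From this alone come
  the measurability of cutoffs, annuli and singletons; the sigma-algebra need not contain all Borel
  sets.\<close>

lemma borel_measurable_dist_of_ball_sets:
  fixes M :: "'a::metric_space measure"
  assumes space: "space M = UNIV" and ball_sets: "\<And>z s. ball z s \<in> sets M"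
  shows "(\<lambda>x. dist x z) \<in> borel_measurable M"
proof (subst borel_measurable_iff_less, intro allI)
  fix a
  have "{w \<in> space M. dist w z < a} = ball z a"
    using space by (auto simp: dist_commute)
  then show "{w \<in> space M. dist w z < a} \<in> sets M"
    using ball_sets by simp
qed

lemma lipschitz_observable_cutoff:
  fixes M :: "'a::metric_space measure"
  assumes "space M = UNIV" and "\<And>z s. ball z s \<in> sets M" and "\<epsilon> > 0"
  shows "lipschitz_observable M (cutoff z s \<epsilon>)"
  unfolding lipschitz_observable_def
proof (intro conjI)
  have [measurable]: "(\<lambda>x. dist x z) \<in> borel_measurable M"
    using borel_measurable_dist_of_ball_sets[OF assms(1,2)] .
  show "cutoff z s \<epsilon> \<in> borel_measurable M"
    unfolding cutoff_def by measurable
  show "bounded (range (cutoff z s \<epsilon>))"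
    by (auto simp: bounded_iff cutoff_nonneg abs_of_nonneg intro!: exI[of _ 1] cutoff_le_1)
  show "\<exists>L. L-lipschitz_on UNIV (cutoff z s \<epsilon>)"
    using lipschitz_on_cutoff[OF assms(3)] by blast
qed

lemma lip_norm_cutoff_le:
  assumes "\<epsilon> > 0"
  shows "lip_norm (cutoff z s \<epsilon>) \<le> 1 + 1 / \<epsilon>"
  by (rule lip_norm_le[OF lipschitz_on_cutoff[OF assms]]) (auto simp: cutoff_nonneg cutoff_le_1)

section \<open>A strong law from a variance bound\<close>

text \<open>Expand the square. A diagonal term is at most E(X_j), since X_j^2 <= X_j on [0, 1]. The
  off-diagonal terms are grouped by their larger index j, so that each group is bounded by
  \<open>cov\<close>; the factor 2 counts both orders of a pair.\<close>

lemma (in prob_space) expectation_square_sum_le: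
  fixes X :: "nat \<Rightarrow> 'a \<Rightarrow> real"
  assumes meas [measurable]: "\<And>k. X k \<in> borel_measurable M"
    and range: "\<And>k x. 0 \<le> X k x" "\<And>k x. X k x \<le> 1"
    and cov: "\<And>j. j \<ge> 1 \<Longrightarrow>
      (\<Sum>i=1..<j. expectation (\<lambda>x. X i x * X j x) - expectation (X i) * expectation (X j))
        \<le> c j * expectation (X j)"
  shows "expectation (\<lambda>x. ((\<Sum>k=1..n. X k x) - (\<Sum>k=1..n. expectation (X k)))\<^sup>2)
    \<le> (\<Sum>j=1..n. (1 + 2 * c j) * expectation (X j))"
proof -
  define Y where "Y k x = X k x - expectation (X k)" for k x
  have Ymeas [measurable]: "Y k \<in> borel_measurable M" for k
    unfolding Y_def by measurable
  have X_int: "integrable M (X k)" for k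
    by (rule integrable_const_bound[of _ 1]) (use range in auto)
  have XX_int: "integrable M (\<lambda>x. X i x * X j x)" for i j
    by (rule integrable_const_bound[of _ 1]) (use range in \<open>auto intro!: mult_le_one\<close>)
  have EX: "0 \<le> expectation (X k)" "expectation (X k) \<le> 1" for k
    using range by (auto intro!: integral_nonneg integral_le_const X_int)
  have YY: "Y i x * Y j x = X i x * X j x - expectation (X i) * X j x
      - expectation (X j) * X i x + expectation (X i) * expectation (X j)" for i j x
    unfolding Y_def by (simp add: algebra_simps)
  have YY_int: "integrable M (\<lambda>x. Y i x * Y j x)" for i j
    unfolding YY using X_int XX_int by simp
  have YY_exp: "expectation (\<lambda>x. Y i x * Y j x)
      = expectation (\<lambda>x. X i x * X j x) - expectation (X i) * expectation (X j)" for i j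
    unfolding YY using X_int XX_int by (simp add: prob_space)
  have YY_diag: "expectation (\<lambda>x. Y j x * Y j x) \<le> expectation (X j)" for j
  proof -
    have "expectation (\<lambda>x. X j x * X j x) \<le> expectation (X j)"
      using range by (intro integral_mono XX_int X_int) (auto intro: mult_left_le)
    then show ?thesis
      unfolding YY_exp using EX[of j] by (smt (verit) mult_nonneg_nonneg)
  qed
  have sq: "(\<Sum>k=1..n. Y k x)\<^sup>2 = (\<Sum>j=1..n. Y j x * Y j x + 2 * (\<Sum>i=1..<j. Y i x * Y j x))" for x n
  proof (induction n)
    case (Suc n)
    have "(\<Sum>k=1..Suc n. Y k x)\<^sup>2
        = (\<Sum>k=1..n. Y k x)\<^sup>2 + Y (Suc n) x * Y (Suc n) x + 2 * ((\<Sum>k=1..n. Y k x) * Y (Suc n) x)"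
      by (simp add: power2_eq_square algebra_simps)
    also have "(\<Sum>k=1..n. Y k x) * Y (Suc n) x = (\<Sum>i=1..<Suc n. Y i x * Y (Suc n) x)"
      by (simp add: sum_distrib_right atLeastLessThanSuc_atLeastAtMost)
    finally show ?case
      using Suc by simp
  qed simp
  have "expectation (\<lambda>x. ((\<Sum>k=1..n. X k x) - (\<Sum>k=1..n. expectation (X k)))\<^sup>2)
      = expectation (\<lambda>x. (\<Sum>k=1..n. Y k x)\<^sup>2)"
    by (simp add: Y_def sum_subtractf)
  also have "\<dots> = (\<Sum>j=1..n. expectation (\<lambda>x. Y j x * Y j x)
      + 2 * (\<Sum>i=1..<j. expectation (\<lambda>x. Y i x * Y j x)))"
    unfolding sq using YY_int by (simp add: Bochner_Integration.integral_sum Bochner_Integration.integral_add)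
  also have "\<dots> \<le> (\<Sum>j=1..n. (1 + 2 * c j) * expectation (X j))"
  proof (rule sum_mono)
    fix j assume "j \<in> {1..n}"
    then have "(\<Sum>i=1..<j. expectation (\<lambda>x. Y i x * Y j x)) \<le> c j * expectation (X j)"
      unfolding YY_exp using cov[of j] by simp
    then show "expectation (\<lambda>x. Y j x * Y j x) + 2 * (\<Sum>i=1..<j. expectation (\<lambda>x. Y i x * Y j x))
        \<le> (1 + 2 * c j) * expectation (X j)"
      using YY_diag[of j] by (simp add: algebra_simps)
  qed
  finally show ?thesis .
qed

text \<open>By monotone convergence the pointwise sum has finite integral, so it is finite almost
  everywhere. Applied to squared relative deviations, this does the work of Chebyshev and
  Borel-Cantelli together.\<close>

lemma AE_summable_of_summable_integral:
  fixes f :: "nat \<Rightarrow> 'a \<Rightarrow> real"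
  assumes int: "\<And>k. integrable M (f k)" and nonneg: "\<And>k x. f k x \<ge> 0"
    and sum: "summable (\<lambda>k. \<integral>x. f k x \<partial>M)"
  shows "AE x in M. summable (\<lambda>k. f k x)"
proof -
  have [measurable]: "f k \<in> borel_measurable M" for k
    using int by auto
  have "(\<integral>\<^sup>+x. (\<Sum>k. ennreal (f k x)) \<partial>M) = (\<Sum>k. \<integral>\<^sup>+x. ennreal (f k x) \<partial>M)"
    by (rule nn_integral_suminf) measurable
  also have "\<dots> = (\<Sum>k. ennreal (\<integral>x. f k x \<partial>M))"
    using int nonneg by (simp add: nn_integral_eq_integral)
  also have "\<dots> = ennreal (\<Sum>k. \<integral>x. f k x \<partial>M)"
    using nonneg sum by (intro suminf_ennreal2) auto
  finally have "(\<integral>\<^sup>+x. (\<Sum>k. ennreal (f k x)) \<partial>M) \<noteq> \<infinity>"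
    by simp
  then have "AE x in M. (\<Sum>k. ennreal (f k x)) \<noteq> \<infinity>"
    by (intro nn_integral_PInf_AE) measurable
  then show ?thesis
    using nonneg by (auto intro!: summable_suminf_not_top)
qed

text \<open>If K^4 <= E n < (K+1)^4, then N K <= n <= N (K+1), and monotonicity of S squeezes S n /
  E n between the ratios at these two indices, up to the factors K^4/(K+1)^4 and ((K+1)^4 + 1)/K^4.
  Both factors tend to 1.\<close>

lemma ratio_tendsto_1_of_quartic_subsequence:
  fixes S E :: "nat \<Rightarrow> real"
  assumes S: "incseq S" "\<And>n. S n \<ge> 0" and E: "incseq E" "E 0 = 0" "\<And>n. E (Suc n) \<le> E n + 1"
    and E_top: "filterlim E at_top sequentially"
    and N_def: "N = (\<lambda>k. LEAST n. real k ^ 4 \<le> E n)"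
    and sub: "(\<lambda>k. S (N k) / E (N k)) \<longlonglongrightarrow> 1"
  shows "(\<lambda>n. S n / E n) \<longlonglongrightarrow> 1"
proof -
  have E_nonneg: "E n \<ge> 0" for n
    using incseqD[OF E(1), of 0 n] E(2) by simp
  have ex: "\<exists>n. a \<le> E n" for a
    using eventually_happens[of "\<lambda>n. a \<le> E n" sequentially] E_top
    by (auto simp: filterlim_at_top)
  have N_ge: "real k ^ 4 \<le> E (N k)" for k
    unfolding N_def using ex by (rule LeastI_ex)
  \<comment> \<open>Since N k is minimal, E was still below k^4 one index earlier, so it overshoots
    by at most one increment.\<close>
  have N_le: "E (N k) \<le> real k ^ 4 + 1" for k
  proof (cases "N k")
    case (Suc m)
    then have "\<not> real k ^ 4 \<le> E m"
      unfolding N_def by (metis lessI not_less_Least)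
    then show ?thesis
      using E(3)[of m] Suc by simp
  qed (use E(2) in simp)
  \<comment> \<open>The last level k^4 that E has reached at n has k = K n.\<close>
  define K where "K n = nat \<lfloor>root 4 (E n)\<rfloor>" for n
  have K1: "real (K n) ^ 4 \<le> E n" for n
  proof -
    have "real (K n) \<le> root 4 (E n)"
      unfolding K_def using E_nonneg[of n] by simp
    then have "real (K n) ^ 4 \<le> root 4 (E n) ^ 4"
      by (intro power_mono) auto
    then show ?thesis
      using E_nonneg by simp
  qed
  have K2: "E n < real (Suc (K n)) ^ 4" for n
  proof -
    have "root 4 (E n) < real (Suc (K n))"
      unfolding K_def using E_nonneg[of n] by (simp; linarith)
    then have "root 4 (E n) ^ 4 < real (Suc (K n)) ^ 4"
      using E_nonneg by (intro power_strict_mono) auto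
    then show ?thesis
      using E_nonneg by simp
  qed
  have K_top: "filterlim K sequentially sequentially"
    unfolding filterlim_at_top
  proof
    fix Z
    have "eventually (\<lambda>n. real Z ^ 4 \<le> E n) sequentially"
      using E_top by (simp add: filterlim_at_top)
    then show "eventually (\<lambda>n. Z \<le> K n) sequentially"
    proof eventually_elim
      case (elim n)
      then have "real Z ^ 4 < real (Suc (K n)) ^ 4"
        using K2[of n] by linarith
      then have "real Z < real (Suc (K n))"
        by (rule power_less_imp_less_base) simp
      then show ?case by simp
    qed
  qed
  define Q where "Q k = S (N k) / E (N k)" for k
  have Q_nonneg: "Q k \<ge> 0" for k
    unfolding Q_def using S(2) E_nonneg by simp
  \<comment> \<open>Level 0 is excluded: E (N 0) = 0, so Q 0 is a division by zero and carries no
    information.\<close>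
  have SQ: "S (N k) = Q k * E (N k)" if "k \<ge> 1" for k
  proof -
    have "0 < real k ^ 4" using that by simp
    then have "E (N k) \<noteq> 0" using N_ge[of k] by linarith
    then show ?thesis unfolding Q_def by simp
  qed
  have lower: "Q (K n) * (real (K n) ^ 4 / real (Suc (K n)) ^ 4) \<le> S n / E n" if "K n \<ge> 1" for n
  proof -
    have "N (K n) \<le> n"
      unfolding N_def by (rule Least_le) (rule K1)
    then have "Q (K n) * E (N (K n)) \<le> S n"
      using incseqD[OF S(1)] SQ[OF that] by metis
    then have "Q (K n) * real (K n) ^ 4 \<le> S n"
      using mult_left_mono[OF N_ge[of "K n"] Q_nonneg[of "K n"]] by linarith
    moreover have "E n > 0"
      using K1[of n] that by (smt (verit) of_nat_1 of_nat_mono one_le_power)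
    ultimately have "Q (K n) * real (K n) ^ 4 / real (Suc (K n)) ^ 4 \<le> S n / E n"
      using K2[of n] S(2)[of n] by (intro frac_le) auto
    then show ?thesis by simp
  qed
  have upper: "S n / E n \<le> Q (Suc (K n)) * ((real (Suc (K n)) ^ 4 + 1) / real (K n) ^ 4)" if "K n \<ge> 1" for n
  proof -
    have "n \<le> N (Suc (K n))"
    proof (rule ccontr)
      assume "\<not> n \<le> N (Suc (K n))"
      then have "E (N (Suc (K n))) \<le> E n"
        by (intro incseqD[OF E(1)]) simp
      then show False using N_ge[of "Suc (K n)"] K2[of n] by linarith
    qed
    then have "S n \<le> Q (Suc (K n)) * E (N (Suc (K n)))"
      using incseqD[OF S(1)] SQ[of "Suc (K n)"] by (metis le_add1 plus_1_eq_Suc)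
    then have "S n \<le> Q (Suc (K n)) * (real (Suc (K n)) ^ 4 + 1)"
      using mult_left_mono[OF N_le[of "Suc (K n)"] Q_nonneg[of "Suc (K n)"]] by linarith
    then have "S n / E n \<le> Q (Suc (K n)) * (real (Suc (K n)) ^ 4 + 1) / real (K n) ^ 4"
      using K1[of n] that S(2)[of n] by (intro frac_le) auto
    then show ?thesis by simp
  qed
  have Q_lim: "Q \<longlonglongrightarrow> 1"
    using sub unfolding Q_def .
  have "(\<lambda>k. real k ^ 4 / real (Suc k) ^ 4) \<longlonglongrightarrow> 1"
    by real_asymp
  from tendsto_mult[OF Q_lim this]
  have "(\<lambda>k. Q k * (real k ^ 4 / real (Suc k) ^ 4)) \<longlonglongrightarrow> 1" by simp
  then have low: "(\<lambda>n. Q (K n) * (real (K n) ^ 4 / real (Suc (K n)) ^ 4)) \<longlonglongrightarrow> 1"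
    using K_top by (rule filterlim_compose)
  have "(\<lambda>k. (real (Suc k) ^ 4 + 1) / real k ^ 4) \<longlonglongrightarrow> 1"
    by real_asymp
  from tendsto_mult[OF LIMSEQ_Suc[OF Q_lim] this]
  have "(\<lambda>k. Q (Suc k) * ((real (Suc k) ^ 4 + 1) / real k ^ 4)) \<longlonglongrightarrow> 1" by simp
  then have up: "(\<lambda>n. Q (Suc (K n)) * ((real (Suc (K n)) ^ 4 + 1) / real (K n) ^ 4)) \<longlonglongrightarrow> 1"
    using K_top by (rule filterlim_compose)
  have ev: "eventually (\<lambda>n. K n \<ge> 1) sequentially"
    using K_top by (simp add: filterlim_at_top)
  show ?thesis
    by (rule tendsto_sandwich[OF _ _ low up]) (use ev lower upper in \<open>auto elim: eventually_mono\<close>)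
qed

text \<open>Dividing the variance bound by E^2 leaves c / sqrt E, which at N k is O(1/k^2) and hence
  summable. This explains the fourth power in N; levels k^2 would give only 1/k.\<close>

lemma (in prob_space) strong_law_of_variance_bound:
  fixes X :: "nat \<Rightarrow> 'a \<Rightarrow> real"
  defines "E \<equiv> \<lambda>n. \<Sum>k=1..n. expectation (X k)"
  assumes meas [measurable]: "\<And>k. X k \<in> borel_measurable M"
    and range: "\<And>k x. 0 \<le> X k x" "\<And>k x. X k x \<le> 1"
    and E_top: "filterlim E at_top sequentially"
    and var: "\<And>n. E n \<ge> 1 \<Longrightarrow> expectation (\<lambda>x. ((\<Sum>k=1..n. X k x) - E n)\<^sup>2) \<le> c * (E n * sqrt (E n))"
  shows "AE x in M. (\<lambda>n. (\<Sum>k=1..n. X k x) / E n) \<longlonglongrightarrow> 1"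
proof -
  define N where "N = (\<lambda>k. LEAST n. real k ^ 4 \<le> E n)"
  define S where "S n x = (\<Sum>k=1..n. X k x)" for n x
  have [measurable]: "S n \<in> borel_measurable M" for n
    unfolding S_def by measurable
  have X_int: "integrable M (X k)" for k
    by (rule integrable_const_bound[of _ 1]) (use range in auto)
  have EX: "0 \<le> expectation (X k)" "expectation (X k) \<le> 1" for k
    using range by (auto intro!: integral_nonneg integral_le_const X_int)
  have incE: "incseq E"
    unfolding E_def using EX by (auto intro!: incseq_SucI)
  have E_Suc: "E (Suc n) \<le> E n + 1" for n
    unfolding E_def using EX by simp
  have S_bounds: "0 \<le> S n x" "S n x \<le> n" for n x
    unfolding S_def using range sum_bounded_above[of "{1..n}" "\<lambda>k. X k x" 1] by (auto intro: sum_nonneg)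
  have ex: "\<exists>n. a \<le> E n" for a
    using eventually_happens[of "\<lambda>n. a \<le> E n" sequentially] E_top
    by (auto simp: filterlim_at_top)
  have N_ge: "real k ^ 4 \<le> E (N k)" for k
    unfolding N_def using ex by (rule LeastI_ex)
  \<comment> \<open>The shift by \<open>Suc\<close> skips level 0, where E vanishes, and ensures E
    >= 1, as \<open>var\<close> demands.\<close>
  define f where "f k x = (S (N (Suc k)) x / E (N (Suc k)) - 1)\<^sup>2" for k x
  have f_int: "integrable M (f k)" for k
  proof -
    have "\<bar>S n x / E n - 1\<bar> \<le> real n / \<bar>E n\<bar> + 1" for n x
    proof -
      have "\<bar>S n x / E n\<bar> \<le> real n / \<bar>E n\<bar>"
        using S_bounds[of n x] by (auto simp: abs_divide intro: divide_right_mono)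
      then show ?thesis by linarith
    qed
    then have "\<bar>S n x / E n - 1\<bar>\<^sup>2 \<le> (real n / \<bar>E n\<bar> + 1)\<^sup>2" for n x
      by (intro power_mono) auto
    then have "\<bar>f k x\<bar> \<le> (real (N (Suc k)) / \<bar>E (N (Suc k))\<bar> + 1)\<^sup>2" for x
      unfolding f_def by simp
    moreover have "f k \<in> borel_measurable M"
      unfolding f_def by measurable
    ultimately show ?thesis
      by (intro integrable_const_bound[of _ "(real (N (Suc k)) / \<bar>E (N (Suc k))\<bar> + 1)\<^sup>2"]) auto
  qed
  have f_le: "expectation (f k) \<le> \<bar>c\<bar> * (1 / real (Suc k) ^ 2)" for k
  proof -
    define e where "e = E (N (Suc k))"
    have e_ge: "e \<ge> real (Suc k) ^ 4"
      unfolding e_def using N_ge .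
    have e1: "e \<ge> 1"
      using e_ge one_le_power[of "real (Suc k)" 4] by linarith
    have sqrt_e: "sqrt e \<ge> real (Suc k) ^ 2"
      by (rule real_le_rsqrt) (use e_ge in simp)
    have "f k x = (S (N (Suc k)) x - e)\<^sup>2 * (1 / e\<^sup>2)" for x
      unfolding f_def e_def[symmetric] using e1 by (simp add: power2_eq_square field_simps)
    then have "f k = (\<lambda>x. (S (N (Suc k)) x - e)\<^sup>2 * (1 / e\<^sup>2))"
      by (rule ext)
    then have "expectation (f k) = expectation (\<lambda>x. (S (N (Suc k)) x - e)\<^sup>2) * (1 / e\<^sup>2)"
      by simp
    also have "\<dots> \<le> (c * (e * sqrt e)) * (1 / e\<^sup>2)"
      using var[of "N (Suc k)"] e1 unfolding e_def S_def by (intro mult_right_mono) auto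
    also have "\<dots> \<le> (\<bar>c\<bar> * (e * sqrt e)) * (1 / e\<^sup>2)"
      using e1 by (intro mult_right_mono) auto
    also have "\<dots> = \<bar>c\<bar> * (sqrt e / e)"
      using e1 by (simp add: power2_eq_square)
    also have "sqrt e / e = 1 / sqrt e"
      using e1 by (simp add: real_div_sqrt divide_simps)
    also have "\<bar>c\<bar> * (1 / sqrt e) \<le> \<bar>c\<bar> * (1 / real (Suc k) ^ 2)"
      using sqrt_e e1 by (intro mult_left_mono divide_left_mono mult_pos_pos) auto
    finally show ?thesis .
  qed
  have "summable (\<lambda>k. 1 / real (Suc k) ^ 2)"
    using inverse_power_summable[of 2, where 'a=real]
    by (subst summable_Suc_iff[of "\<lambda>k. 1 / real k ^ 2"]) (simp add: inverse_eq_divide)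
  then have "summable (\<lambda>k. \<bar>c\<bar> * (1 / real (Suc k) ^ 2))"
    by (rule summable_mult)
  then have "summable (\<lambda>k. expectation (f k))"
    by (rule summable_comparison_test'[of _ 0]) (use f_le in \<open>auto simp: f_def abs_of_nonneg\<close>)
  then have "AE x in M. summable (\<lambda>k. f k x)"
    by (rule AE_summable_of_summable_integral[OF f_int, rotated]) (simp add: f_def)
  then show ?thesis
  proof (rule AE_mp, intro AE_I2 impI)
    fix x assume "summable (\<lambda>k. f k x)"
    then have "(\<lambda>k. f k x) \<longlonglongrightarrow> 0"
      by (rule summable_LIMSEQ_zero)
    then have "(\<lambda>k. sqrt (f k x)) \<longlonglongrightarrow> 0"
      using tendsto_real_sqrt by fastforce
    then have "(\<lambda>k. S (N (Suc k)) x / E (N (Suc k)) - 1) \<longlonglongrightarrow> 0"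
      unfolding f_def by (simp add: tendsto_rabs_zero_iff)
    then have "(\<lambda>k. S (N (Suc k)) x / E (N (Suc k))) \<longlonglongrightarrow> 1"
      by (simp add: LIM_zero_iff)
    then have "(\<lambda>k. S (N k) x / E (N k)) \<longlonglongrightarrow> 1"
      by (rule LIMSEQ_imp_Suc)
    moreover have "incseq (\<lambda>n. S n x)"
      unfolding S_def using range by (intro incseq_SucI) simp
    moreover have "E 0 = 0"
      by (simp add: E_def)
    ultimately have "(\<lambda>n. S n x / E n) \<longlonglongrightarrow> 1"
      by (intro ratio_tendsto_1_of_quartic_subsequence[OF _ S_bounds(1) incE _ E_Suc E_top N_def])
    then show "(\<lambda>n. (\<Sum>k=1..n. X k x) / E n) \<longlonglongrightarrow> 1"
      unfolding S_def .
  qed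
qed

section \<open>Stationarity and the measure of balls\<close>

lemma measure_preserving_funpow:
  assumes "measure_preserving M T"
  shows "T ^^ k \<in> measurable M M" and "distr M M (T ^^ k) = M"
proof -
  have T [measurable]: "T \<in> measurable M M"
    using assms by (simp add: measure_preserving_def)
  show meas: "T ^^ k \<in> measurable M M" for k
    by (rule measurable_compose_n) (rule T)
  have distr_T: "distr M M T = M"
    by (rule measure_eqI) (use assms in \<open>auto simp: measure_preserving_def emeasure_distr\<close>)
  show "distr M M (T ^^ k) = M"
  proof (induction k)
    case (Suc k)
    have "distr M M (T ^^ Suc k) = distr (distr M M (T ^^ k)) M T"
      using meas by (simp add: distr_distr)
    then show ?case
      using Suc distr_T by metis
  qed (simp add: id_def)
qed

lemma integral_comp_measure_preserving:
  fixes f :: "'a \<Rightarrow> real"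
  assumes "measure_preserving M T" and f: "f \<in> borel_measurable M"
  shows "(\<integral>x. f ((T ^^ k) x) \<partial>M) = (\<integral>x. f x \<partial>M)"
  using integral_distr[OF measure_preserving_funpow(1)[OF assms(1), of k] f]
    measure_preserving_funpow(2)[OF assms(1), of k] by simp

text \<open>Telescoping: for t = n + 1 >= 3, the increment of the squared logarithm from t to t + 1
  factors as a difference, at most 1/t, times a sum, at most 3 ln t; so it is at most 3 (ln t)/t <=
  3 m(t). The 4 covers the first values, where ln t >= 1 fails. Later this trades logarithms for
  square roots of E_n.\<close>

lemma square_ln_le_sum:
  fixes m :: "nat \<Rightarrow> real"
  assumes m: "\<And>i. i \<ge> 1 \<Longrightarrow> m i \<ge> ln (real i) / real i"
  shows "(ln (real (Suc n)))\<^sup>2 \<le> 3 * (\<Sum>k=1..n. m k) + 4"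
proof (induction n)
  case (Suc n)
  have nonneg: "m k \<ge> 0" if "k \<ge> 1" for k
    using m[OF that] that by (smt (verit) divide_nonneg_nonneg ln_ge_zero of_nat_0_le_iff of_nat_1 of_nat_mono)
  show ?case
  proof (cases "Suc n \<ge> 3")
    case False
    have "real (Suc (Suc n)) \<le> 3" using False by simp
    then have "ln (real (Suc (Suc n))) \<le> ln 3"
      by simp
    also have "ln 3 \<le> (2::real)"
      using ln_le_minus_one[of 3] by simp
    finally have "(ln (real (Suc (Suc n))))\<^sup>2 \<le> 2\<^sup>2"
      by (intro power_mono) auto
    also have "2\<^sup>2 = (4::real)" by simp
    finally have "(ln (real (Suc (Suc n))))\<^sup>2 \<le> 4" .
    moreover have "(\<Sum>k=1..Suc n. m k) \<ge> 0"
      using nonneg by (intro sum_nonneg) auto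
    ultimately show ?thesis by linarith
  next
    case True
    define t where "t = real (Suc n)"
    have t: "t \<ge> 3" "t + 1 = real (Suc (Suc n))"
      using True unfolding t_def by auto
    have "1 \<le> ln t"
      using t exp_le by (subst ln_ge_iff) auto
    have d: "ln (t + 1) - ln t \<le> 1 / t"
      using t ln_diff_le[of "t + 1" t] by simp
    have d0: "ln (t + 1) - ln t \<ge> 0"
      using t by simp
    have "1 / t \<le> ln t"
      using \<open>1 \<le> ln t\<close> t by (smt (verit) divide_le_eq_1)
    have "(ln (t + 1))\<^sup>2 - (ln t)\<^sup>2 = (ln (t + 1) - ln t) * (ln (t + 1) + ln t)"
      by (simp add: power2_eq_square algebra_simps)
    also have "\<dots> \<le> (1 / t) * (3 * ln t)"
      using d d0 t \<open>1 \<le> ln t\<close> \<open>1 / t \<le> ln t\<close> by (intro mult_mono) auto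
    also have "\<dots> = 3 * (ln t / t)" by simp
    also have "\<dots> \<le> 3 * m (Suc n)"
      using m[of "Suc n"] unfolding t_def by simp
    finally show ?thesis
      using Suc t unfolding t_def by simp
  qed
qed simp

text \<open>The ball without its centre is covered by annuli whose outer radii s (2/3)^j decrease
  geometrically. Condition (B) bounds their measures by a geometric series of ratio (2/3)^\<delta>.
  The second point z rules out an atom at p, because p lies in arbitrarily thin annuli about
  z.\<close>

lemma measure_ball_le_powr:
  fixes M :: "'a::metric_space measure"
  assumes prob: "prob_space M" and space: "space M = UNIV"
    and ball_sets: "\<And>z s. ball z s \<in> sets M"
    and \<delta>: "0 < \<delta>"
    and annulus: "\<And>z s \<epsilon>. 0 < \<epsilon> \<Longrightarrow> \<epsilon> < s \<Longrightarrow> s \<le> r0 \<Longrightarrow>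
      measure M {x. s < dist x z \<and> dist x z < s + \<epsilon>} < \<epsilon> powr \<delta>"
    and z: "z \<noteq> p" "dist z p \<le> r0" and s: "0 < s" "s \<le> r0"
  shows "measure M (ball p s) \<le> s powr \<delta> / (1 - (2/3) powr \<delta>)"
proof -
  interpret prob_space M by (rule prob)
  have [measurable]: "(\<lambda>x. dist x z) \<in> borel_measurable M" for z
    using borel_measurable_dist_of_ball_sets[OF space ball_sets] .
  have ann_sets: "{x. a < dist x z \<and> dist x z < b} \<in> sets M" for a b z
  proof -
    have "{x \<in> space M. a < dist x z \<and> dist x z < b} \<in> sets M" by measurable
    then show ?thesis using space by simp
  qed
  have p_sets: "{p} \<in> sets M"
  proof -
    have "{x \<in> space M. dist x p \<le> 0} \<in> sets M" by measurable
    then show ?thesis using space by simp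
  qed
  have p0: "measure M {p} = 0"
  proof -
    define D where "D = dist p z"
    have D: "0 < D" "D \<le> r0"
      using z by (auto simp: D_def dist_commute)
    \<comment> \<open>The sphere through p about z, of radius D, is the middle of an annulus of
      width e. Taking e < D/2 keeps that width below the inner radius D - e/2.\<close>
    have "eventually (\<lambda>e. measure M {p} \<le> e powr \<delta>) (at_right 0)"
      using eventually_at_right_real[of 0 "D/2", OF half_gt_zero[OF D(1)]]
    proof eventually_elim
      case (elim e)
      then have elim: "0 < e" "e < D/2" by auto
      have "measure M {p} \<le> measure M {x. D - e/2 < dist x z \<and> dist x z < (D - e/2) + e}"
        using elim by (intro finite_measure_mono ann_sets) (auto simp: D_def)
      also have "\<dots> < e powr \<delta>"
        using elim D by (intro annulus) auto
      finally show ?case by simp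
    qed
    moreover have "((\<lambda>e. e powr \<delta>) \<longlongrightarrow> 0) (at_right (0::real))"
    proof -
      have "((\<lambda>e. e powr \<delta>) \<longlongrightarrow> 0 powr \<delta>) (at_right (0::real))"
        using \<delta> by (intro tendsto_powr') (auto intro: tendsto_ident_at simp: eventually_at_right_less eventually_mono[OF eventually_at_right_less[of 0]])
      then show ?thesis by simp
    qed
    ultimately have "measure M {p} \<le> 0"
      by (intro tendsto_lowerbound) auto
    then show ?thesis
      by (simp add: measure_le_0_iff)
  qed
  define a where "a j = s * (2/3) ^ j" for j :: nat
  have a_pos: "a j > 0" for j
    unfolding a_def using s by simp
  have a_le: "a j \<le> s" for j
    unfolding a_def using s by (simp add: mult_left_le power_le_one)
  \<comment> \<open>The annulus bound needs \<open>\<epsilon> < s\<close>, hence an inner radius above half the outer one;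
    \<open>3/5 < 2/3\<close> makes consecutive open annuli overlap, so that no sphere is missed.\<close>
  define A where "A j = {x. 3/5 * a j < dist x p \<and> dist x p < a j}" for j
  have A_sets: "A j \<in> sets M" for j
    unfolding A_def by (rule ann_sets)
  define q where "q = (2/3) powr \<delta>"
  have q: "0 < q" "q < 1"
    unfolding q_def using \<delta> powr_less_mono2[of \<delta> "2/3" 1] by auto
  have A_le: "measure M (A j) \<le> s powr \<delta> * q ^ j" for j
  proof -
    have "measure M (A j) = measure M {x. 3/5 * a j < dist x p \<and> dist x p < 3/5 * a j + 2/5 * a j}"
      unfolding A_def by (simp add: distrib_right[symmetric])
    also have "\<dots> < (2/5 * a j) powr \<delta>"
      using a_pos[of j] a_le[of j] s by (intro annulus) auto
    also have "\<dots> \<le> a j powr \<delta>"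
      using a_pos[of j] \<delta> by (intro powr_mono2) auto
    also have "\<dots> = s powr \<delta> * q ^ j"
      unfolding a_def q_def using s
      by (simp add: powr_mult powr_realpow[symmetric] powr_powr powr_powr_swap mult.commute)
    finally show ?thesis by simp
  qed
  have sums: "(\<lambda>j. s powr \<delta> * q ^ j) sums (s powr \<delta> * (1 / (1 - q)))"
    using q by (intro sums_mult geometric_sums) auto
  have summ: "summable (\<lambda>j. measure M (A j))"
    by (rule summable_comparison_test'[OF sums_summable[OF sums], of 0]) (use A_le in auto)
  have cover: "ball p s \<subseteq> {p} \<union> (\<Union>j. A j)"
  proof
    fix x assume "x \<in> ball p s"
    then have d: "dist x p < s" by (simp add: dist_commute)
    show "x \<in> {p} \<union> (\<Union>j. A j)"
    proof (cases "x = p")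
      case False
      then have "dist x p / s > 0" using s by simp
      then have ex: "\<exists>j. (2/3) ^ j < dist x p / s"
        by (intro real_arch_pow_inv) auto
      \<comment> \<open>The first j with a j < dist x p; its predecessor i satisfies 2/3 * a i <
        dist x p <= a i. In the case of equality x escapes the open annulus A i but lies in the
        preceding one, which exists because dist x p < s = a 0.\<close>
      define j where "j = (LEAST j. (2/3) ^ j < dist x p / s)"
      have j: "(2/3) ^ j < dist x p / s"
        unfolding j_def using ex by (rule LeastI_ex)
      have "j \<noteq> 0"
        using j d s by (cases j) (auto simp: field_simps)
      then obtain i where i: "j = Suc i" by (cases j) auto
      have "\<not> (2/3) ^ i < dist x p / s"
        using not_less_Least[of i "\<lambda>j. (2/3) ^ j < dist x p / s"] i unfolding j_def by simp
      then have up: "dist x p \<le> a i"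
        unfolding a_def using s by (simp add: field_simps)
      have low: "2/3 * a i < dist x p"
        using j s unfolding i a_def by (simp add: field_simps)
      show ?thesis
      proof (cases "dist x p = a i")
        case True
        have "i \<noteq> 0"
          using True d by (cases i) (auto simp: a_def)
        then obtain h where "i = Suc h" by (cases i) auto
        then have "a i = 2/3 * a h" by (simp add: a_def)
        then have "x \<in> A h"
          using True a_pos[of h] by (auto simp: A_def)
        then show ?thesis by blast
      next
        case False
        then have "x \<in> A i"
          using up low a_pos[of i] by (auto simp: A_def)
        then show ?thesis by blast
      qed
    qed simp
  qed
  have UN_sets: "(\<Union>j. A j) \<in> sets M"
    using A_sets by auto
  have "measure M (ball p s) \<le> measure M ({p} \<union> (\<Union>j. A j))"
    using UN_sets p_sets by (intro finite_measure_mono cover sets.Un)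
  also have "\<dots> \<le> measure M {p} + measure M (\<Union>j. A j)"
    using UN_sets p_sets by (intro measure_Un_le)
  also have "measure M (\<Union>j. A j) \<le> (\<Sum>j. measure M (A j))"
    using A_sets summ by (intro finite_measure_subadditive_countably) auto
  also have "(\<Sum>j. measure M (A j)) \<le> (\<Sum>j. s powr \<delta> * q ^ j)"
    by (intro suminf_le A_le summ sums_summable[OF sums])
  also have "(\<Sum>j. s powr \<delta> * q ^ j) = s powr \<delta> * (1 / (1 - q))"
    using sums by (simp add: sums_iff)
  finally show ?thesis
    using p0 by (simp add: q_def)
qed

section \<open>Correlations of the hits\<close>

text \<open>Condition (B) speaks of radii up to r0; \<open>radii\<close> places all but finitely
  many of the balls in that range.\<close>

locale shrinking_balls = prob_space M
  for M :: "'a::metric_space measure" +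
  fixes T :: "'a \<Rightarrow> 'a" and rate :: "nat \<Rightarrow> real" and C \<alpha> r0 \<delta> :: real
    and p :: "nat \<Rightarrow> 'a" and r :: "nat \<Rightarrow> real"
  assumes space: "space M = UNIV"
    and ball_sets [measurable]: "\<And>z s. ball z s \<in> sets M"
    and preserving: "measure_preserving M T"
    and C: "C > 0" and \<alpha>: "0 < \<alpha>" "\<alpha> < 1"
    and rate: "\<And>k. k \<ge> 1 \<Longrightarrow> rate k \<le> C * \<alpha> ^ k"
    and decay: "\<And>\<phi> \<psi> k. lipschitz_observable M \<phi> \<Longrightarrow> lipschitz_observable M \<psi> \<Longrightarrow> k \<ge> 1 \<Longrightarrow>
      \<bar>(\<integral>x. \<phi> x * \<psi> ((T ^^ k) x) \<partial>M) - (\<integral>x. \<phi> x \<partial>M) * (\<integral>x. \<psi> x \<partial>M)\<bar>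
        \<le> rate k * lip_norm \<phi> * lip_norm \<psi>"
    and r0: "r0 > 0" and \<delta>: "0 < \<delta>" "\<delta> < 1"
    and annulus: "\<And>z s \<epsilon>. 0 < \<epsilon> \<Longrightarrow> \<epsilon> < s \<Longrightarrow> s \<le> r0 \<Longrightarrow>
      measure M {x. s < dist x z \<and> dist x z < s + \<epsilon>} < \<epsilon> powr \<delta>"
    and radii: "\<forall>\<^sub>F i in sequentially. r i \<le> r0"
    and balls: "\<And>i. i \<ge> 1 \<Longrightarrow> measure M (ball (p i) (r i)) \<ge> ln (real i) / real i"
begin

section \<open>Hits and their expectations\<close>

abbreviation B :: "nat \<Rightarrow> 'a set" where
  "B i \<equiv> ball (p i) (r i)"

abbreviation \<mu> :: "nat \<Rightarrow> real" where
  "\<mu> i \<equiv> measure M (B i)"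

definition hit :: "nat \<Rightarrow> 'a \<Rightarrow> real" where
  "hit k x = indicator (B k) ((T ^^ k) x)"

lemma measurable_funpow_T [measurable]: "T ^^ k \<in> measurable M M"
  using measure_preserving_funpow(1)[OF preserving] .

lemma measurable_hit [measurable]: "hit k \<in> borel_measurable M"
  unfolding hit_def by measurable

lemma hit_bounds: "0 \<le> hit k x" "hit k x \<le> 1"
  by (auto simp: hit_def indicator_def)

lemma expectation_hit: "expectation (hit k) = \<mu> k"
  unfolding hit_def
  by (subst integral_comp_measure_preserving[OF preserving, of "indicator (B k)"])
    (use space in auto)

lemma expectation_hit_mult_le: "expectation (\<lambda>x. hit i x * hit j x) \<le> \<mu> j"
proof -
  have "expectation (\<lambda>x. hit i x * hit j x) \<le> expectation (hit j)"
  proof (rule integral_mono)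
    show "integrable M (\<lambda>x. hit i x * hit j x)"
      by (rule integrable_const_bound[of _ 1]) (auto simp: abs_mult hit_bounds intro!: mult_le_one)
    show "integrable M (hit j)"
      by (rule integrable_const_bound[of _ 1]) (auto simp: hit_bounds)
  qed (auto simp: hit_def indicator_def)
  then show ?thesis by (simp add: expectation_hit)
qed

text \<open>3 is the first integer above e, so ln i >= 1 from there on. The weaker bound 1/i
  suffices for bounding radii from below and for absorbing the covariances of distant pairs.\<close>

lemma \<mu>_ge: "i \<ge> 3 \<Longrightarrow> \<mu> i \<ge> 1 / real i"
proof -
  assume "i \<ge> 3"
  then have "1 \<le> ln (real i)"
    using exp_le by (subst ln_ge_iff) auto
  then have "1 / real i \<le> ln (real i) / real i"
    by (intro divide_right_mono) auto
  then show ?thesis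
    using balls[of i] \<open>i \<ge> 3\<close> by linarith
qed

section \<open>Lipschitz majorants of the ball indicators\<close>

lemma expectation_cutoff_le:
  assumes "0 < \<epsilon>" "3 * \<epsilon> < s" "s \<le> r0"
  shows "expectation (cutoff z s \<epsilon>) \<le> measure M (ball z s) + (2 * \<epsilon>) powr \<delta>"
proof -
  \<comment> \<open>The cutoff exceeds the indicator only where s <= dist x z < s + \<epsilon>.
    Starting the annulus at s - \<epsilon> includes the sphere of radius s, which both the open ball
    and an open annulus of inner radius s would miss. The width 2\<epsilon> must stay below the
    inner radius s - \<epsilon>, hence 3\<epsilon> < s.\<close>
  let ?A = "{x. s - \<epsilon> < dist x z \<and> dist x z < (s - \<epsilon>) + 2 * \<epsilon>}"
  have [measurable]: "(\<lambda>x. dist x z) \<in> borel_measurable M" for z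
    using borel_measurable_dist_of_ball_sets[OF space ball_sets] .
  have "{x \<in> space M. s - \<epsilon> < dist x z \<and> dist x z < (s - \<epsilon>) + 2 * \<epsilon>} \<in> sets M" by measurable
  then have A [measurable]: "?A \<in> sets M" using space by simp
  have cut: "lipschitz_observable M (cutoff z s \<epsilon>)"
    using assms by (intro lipschitz_observable_cutoff space ball_sets)
  have "expectation (cutoff z s \<epsilon>) \<le> expectation (\<lambda>x. indicator (ball z s) x + indicator ?A x)"
  proof (rule integral_mono)
    show "integrable M (cutoff z s \<epsilon>)"
      by (rule integrable_const_bound[of _ 1])
        (use cut in \<open>auto simp: lipschitz_observable_def cutoff_nonneg cutoff_le_1\<close>)
    show "integrable M (\<lambda>x. indicator (ball z s) x + indicator ?A x :: real)"
      by (intro Bochner_Integration.integrable_add integrable_real_indicator A ball_sets) (auto simp: emeasure_eq_measure)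
    show "cutoff z s \<epsilon> x \<le> indicator (ball z s) x + indicator ?A x" for x
    proof (cases "dist x z < s + \<epsilon>")
      case True
      have "x \<in> ball z s \<or> x \<in> ?A"
        using True assms by (auto simp: dist_commute)
      then have "1 \<le> (indicator (ball z s) x + indicator ?A x :: real)"
        by (auto simp: indicator_def simp del: mem_ball)
      then show ?thesis
        using cutoff_le_1[of z s \<epsilon> x] by linarith
    next
      case False
      then show ?thesis
        using cutoff_eq_0[of s \<epsilon> x z] assms by (auto simp: indicator_def)
    qed
  qed
  also have "\<dots> = measure M (ball z s) + measure M ?A"
    by (subst Bochner_Integration.integral_add)
      (use space A ball_sets in \<open>auto simp: emeasure_eq_measure\<close>)
  also have "measure M ?A < (2 * \<epsilon>) powr \<delta>"
    using assms by (intro annulus) auto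
  finally show ?thesis by simp
qed

text \<open>The annuli get width j^(-b). With b\<delta> >= 3 their measure is O(j^(-3)), one power
  better than the target j^(-2), and the spare power absorbs constants.\<close>

definition b :: nat where
  "b = nat \<lceil>3 / \<delta>\<rceil>"

lemma b: "b \<ge> 1" "b * \<delta> \<ge> 3"
proof -
  have "3 / \<delta> \<le> real b" "3 / \<delta> > 0"
    unfolding b_def using \<delta> by (auto intro: real_nat_ceiling_ge simp del: of_nat_nat)
  then have "real b > 0" by linarith
  then show "b \<ge> 1" by simp
  show "b * \<delta> \<ge> 3"
    using \<open>3 / \<delta> \<le> real b\<close> \<delta> by (simp add: field_simps)
qed

lemma powr_b_le:
  assumes "j \<ge> 1"
  shows "(1 / real j ^ b) powr \<delta> \<le> 1 / real j ^ 3"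
proof -
  have "(1 / real j ^ b) powr \<delta> = real j powr (- (b * \<delta>))"
    using assms by (simp add: powr_realpow[symmetric] powr_minus_divide[symmetric] powr_powr)
  also have "\<dots> \<le> real j powr (- 3)"
    using assms b by (intro powr_mono) auto
  also have "\<dots> = 1 / real j ^ 3"
    using assms by (simp add: powr_minus_divide powr_numeral)
  finally show ?thesis .
qed

text \<open>The precision is set by j rather than i, since in a pair i < j both balls are
  approximated at the scale of the later one; N is uniform in both.\<close>

lemma lipschitz_majorant:
  obtains N where "N \<ge> 3" and "\<And>i j. N \<le> i \<Longrightarrow> i \<le> j \<Longrightarrow>
    \<exists>f. lipschitz_observable M f \<and> (\<forall>x. indicator (B i) x \<le> f x \<and> f x \<le> 1) \<and>
      expectation f \<le> \<mu> i + 1 / real j ^ 2 \<and> lip_norm f \<le> 2 * real j ^ b"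
proof -
  define D where "D = 1 / (1 - (2/3) powr \<delta>)"
  have "(2/3) powr \<delta> < 1"
    using \<delta> powr_less_mono2[of \<delta> "2/3" 1] by auto
  then have D: "D > 0" unfolding D_def by simp
  obtain N0 where N0: "\<And>i. i \<ge> N0 \<Longrightarrow> r i \<le> r0"
    using radii by (auto simp: eventually_sequentially)
  \<comment> \<open>The four demands on N: 3 for \<open>\<mu>_ge\<close>, N0 for r i <= r0, 1/r0 so
    that the norm 1 + 1/r0 of an isolated point's cutoff is at most 2 j^b, and 3D for the
    contradiction in \<open>small\<close>.\<close>
  define N where "N = max (max 3 N0) (max (nat \<lceil>1 / r0\<rceil>) (nat \<lceil>3 * D\<rceil>))"
  have N: "N \<ge> 3" "N \<ge> N0" "real N \<ge> 1 / r0" "real N \<ge> 3 * D"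
  proof -
    show "N \<ge> 3" "N \<ge> N0" unfolding N_def by linarith+
    have "1 / r0 \<le> real (nat \<lceil>1 / r0\<rceil>)" "3 * D \<le> real (nat \<lceil>3 * D\<rceil>)"
      by (rule real_nat_ceiling_ge)+
    moreover have "nat \<lceil>1 / r0\<rceil> \<le> N" "nat \<lceil>3 * D\<rceil> \<le> N"
      unfolding N_def by linarith+
    ultimately show "real N \<ge> 1 / r0" "real N \<ge> 3 * D"
      by linarith+
  qed
  show thesis
  proof (rule that[OF N(1)])
    fix i j assume ij: "N \<le> i" "i \<le> j"
    have j: "real j \<ge> 3" "real j \<ge> 1 / r0" "real j \<ge> 3 * D" "j \<ge> 1"
      using N ij by linarith+
    have jb: "real j \<le> real j ^ b"
      using b(1) j by (intro self_le_power) auto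
    have ri: "r i \<le> r0" using N0 N ij by simp
    have \<mu>i: "\<mu> i \<ge> 1 / real j"
    proof -
      have "1 / real j \<le> 1 / real i"
        using N ij by (intro divide_left_mono) auto
      then show ?thesis using \<mu>_ge[of i] N ij by linarith
    qed
    then have "\<mu> i > 0"
      using j by (smt (verit) zero_less_divide_1_iff)
    then have ri_pos: "r i > 0"
      by (rule contrapos_pp) (simp add: ball_empty)
    show "\<exists>f. lipschitz_observable M f \<and> (\<forall>x. indicator (B i) x \<le> f x \<and> f x \<le> 1) \<and>
      expectation f \<le> \<mu> i + 1 / real j ^ 2 \<and> lip_norm f \<le> 2 * real j ^ b"
    proof (cases "\<exists>z. z \<noteq> p i \<and> dist z (p i) \<le> r0")
      case False
      then have Bi: "B i = {p i}"
        using ri ri_pos by (auto simp: dist_commute)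
      \<comment> \<open>Every other point is farther than r0 from p i, where this cutoff has already
        dropped to 0.\<close>
      have cut: "cutoff (p i) 0 r0 = indicator (B i)"
      proof
        fix x
        show "cutoff (p i) 0 r0 x = indicator (B i) x"
          unfolding Bi using False r0 cutoff_eq_1[of x "p i" 0 r0] cutoff_eq_0[of 0 r0 x "p i"]
          by (cases "x = p i") (force simp: indicator_def)+
      qed
      have "lip_norm (cutoff (p i) 0 r0) \<le> 2 * real j ^ b"
        using lip_norm_cutoff_le[OF r0, of "p i" 0] jb j by linarith
      moreover have "expectation (cutoff (p i) 0 r0) = \<mu> i"
        unfolding cut using space by simp
      ultimately show ?thesis
        using lipschitz_observable_cutoff[OF space ball_sets r0, of "p i" 0] cut
        by (intro exI[of _ "cutoff (p i) 0 r0"]) (auto simp: cutoff_le_1)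
    next
      case True
      then obtain z where z: "z \<noteq> p i" "dist z (p i) \<le> r0" by blast
      define \<epsilon> where "\<epsilon> = 1 / real j ^ b"
      have \<epsilon>: "\<epsilon> > 0" unfolding \<epsilon>_def using j by simp
      have \<epsilon>_powr: "\<epsilon> powr \<delta> \<le> 1 / real j ^ 3"
        unfolding \<epsilon>_def using j by (intro powr_b_le)
      have mult_le: "(c * \<epsilon>) powr \<delta> \<le> c * (1 / real j ^ 3)" if "c \<ge> 1" for c
      proof -
        have "(c * \<epsilon>) powr \<delta> = c powr \<delta> * \<epsilon> powr \<delta>"
          using that \<epsilon> by (simp add: powr_mult)
        also have "c powr \<delta> \<le> c powr 1"
          using that \<delta> by (intro powr_mono) auto
        then have "c powr \<delta> * \<epsilon> powr \<delta> \<le> c * (1 / real j ^ 3)"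
          using that \<epsilon>_powr by (intro mult_mono) auto
        finally show ?thesis .
      qed
      \<comment> \<open>A ball of radius at most 3\<epsilon> would have measure at most 3D/j^3.
        Against the lower bound 1/j this forces j^2 <= 3D, although j >= 3D and j > 1.\<close>
      have small: "3 * \<epsilon> < r i"
      proof (rule ccontr)
        assume "\<not> 3 * \<epsilon> < r i"
        have "1 / real j \<le> D * r i powr \<delta>"
          using \<mu>i measure_ball_le_powr[OF prob_space_axioms space ball_sets \<delta>(1) annulus z ri_pos ri]
          unfolding D_def by simp
        also have "\<dots> \<le> D * (3 * \<epsilon>) powr \<delta>"
          using D \<delta> ri_pos \<open>\<not> 3 * \<epsilon> < r i\<close> by (intro mult_left_mono powr_mono2) auto
        also have "\<dots> \<le> D * (3 * (1 / real j ^ 3))"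
          using D mult_le[of 3] by (intro mult_left_mono) auto
        finally have "real j ^ 2 \<le> 3 * D"
          using j by (simp add: field_simps power2_eq_square power3_eq_cube)
        moreover have "real j < real j ^ 2"
          using j by (simp add: power2_eq_square)
        ultimately show False using j by linarith
      qed
      have "expectation (cutoff (p i) (r i) \<epsilon>) \<le> \<mu> i + (2 * \<epsilon>) powr \<delta>"
        by (rule expectation_cutoff_le[OF \<epsilon> small ri])
      also have "(2 * \<epsilon>) powr \<delta> \<le> 2 * (1 / real j ^ 3)"
        by (rule mult_le) simp
      also have "\<dots> \<le> 1 / real j ^ 2"
        using j by (simp add: field_simps power2_eq_square power3_eq_cube)
      finally have "expectation (cutoff (p i) (r i) \<epsilon>) \<le> \<mu> i + 1 / real j ^ 2" by simp
      moreover have "lip_norm (cutoff (p i) (r i) \<epsilon>) \<le> 2 * real j ^ b"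
      proof -
        have "1 / \<epsilon> = real j ^ b" unfolding \<epsilon>_def by simp
        then show ?thesis
          using lip_norm_cutoff_le[OF \<epsilon>, of "p i" "r i"] jb j by linarith
      qed
      moreover have "indicator (B i) x \<le> cutoff (p i) (r i) \<epsilon> x" for x
        using cutoff_eq_1[of x "p i" "r i" \<epsilon>] \<epsilon> cutoff_nonneg[of "p i" "r i" \<epsilon> x]
        by (auto simp: indicator_def dist_commute)
      ultimately show ?thesis
        using lipschitz_observable_cutoff[OF space ball_sets \<epsilon>, of "p i" "r i"]
        by (intro exI[of _ "cutoff (p i) (r i) \<epsilon>"]) (auto simp: cutoff_le_1)
    qed
  qed
qed

section \<open>Covariance estimates\<close>

definition \<kappa> :: real where
  "\<kappa> = (2 * b + 2) / (- ln \<alpha>)"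

lemma \<kappa>_nonneg: "\<kappa> \<ge> 0"
  unfolding \<kappa>_def using \<alpha> by (intro divide_nonneg_nonneg) auto

text \<open>\<kappa> solves \<alpha>^(\<kappa> ln j) = j^(-(2b+2)). Beyond a gap of \<kappa> ln j,
  mixing therefore beats the product of two Lipschitz norms of order j^b and still leaves
  j^(-2).\<close>

lemma \<alpha>_power_le:
  assumes "j \<ge> 1" "\<kappa> * ln (real j) \<le> real k"
  shows "\<alpha> ^ k \<le> 1 / real j ^ (2 * b + 2)"
proof -
  have l: "- ln \<alpha> > 0" using \<alpha> by simp
  have "real (2 * b + 2) * ln (real j) = (- ln \<alpha>) * (\<kappa> * ln (real j))"
    unfolding \<kappa>_def using l by simp
  also have "\<dots> \<le> (- ln \<alpha>) * real k"
    using assms l by (intro mult_left_mono) auto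
  finally have "real k * ln \<alpha> \<le> - (real (2 * b + 2) * ln (real j))"
    by (simp add: mult.commute)
  then have "exp (real k * ln \<alpha>) \<le> exp (- (real (2 * b + 2) * ln (real j)))"
    by simp
  also have "\<dots> = 1 / exp (real (2 * b + 2) * ln (real j))"
    by (simp only: exp_minus inverse_eq_divide)
  also have "exp (real (2 * b + 2) * ln (real j)) = real j ^ (2 * b + 2)"
    using assms by (simp only: exp_of_nat_mult exp_ln)
  also have "exp (real k * ln \<alpha>) = \<alpha> ^ k"
    using \<alpha> by (simp only: exp_of_nat_mult exp_ln)
  finally show ?thesis .
qed

text \<open>Only an upper bound on the covariance is wanted, so majorants of both indicators
  suffice. Invariance under T^i moves the pair of times to 0 and k = j - i, where decay applies. The
  3 comes from the excess in the two expectations, the 4C from the two norms 2 j^b.\<close>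

lemma covariance_le:
  obtains N where "N \<ge> 3" and "\<And>i j. N \<le> i \<Longrightarrow> i < j \<Longrightarrow> \<kappa> * ln (real j) \<le> real (j - i) \<Longrightarrow>
    expectation (\<lambda>x. hit i x * hit j x) - \<mu> i * \<mu> j \<le> (3 + 4 * C) / real j ^ 2"
proof -
  obtain N where N: "N \<ge> 3" and maj: "\<And>i j. N \<le> i \<Longrightarrow> i \<le> j \<Longrightarrow>
    \<exists>f. lipschitz_observable M f \<and> (\<forall>x. indicator (B i) x \<le> f x \<and> f x \<le> 1) \<and>
      expectation f \<le> \<mu> i + 1 / real j ^ 2 \<and> lip_norm f \<le> 2 * real j ^ b"
    using lipschitz_majorant by blast
  show thesis
  proof (rule that[OF N])
    fix i j assume ij: "N \<le> i" "i < j" and far: "\<kappa> * ln (real j) \<le> real (j - i)"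
    define k where "k = j - i"
    have k: "k \<ge> 1" "j = k + i" using ij unfolding k_def by auto
    have j: "real j \<ge> 1" "j \<ge> 1" using ij N by auto
    obtain f where f: "lipschitz_observable M f" "\<And>x. indicator (B i) x \<le> f x" "\<And>x. f x \<le> 1"
      "expectation f \<le> \<mu> i + 1 / real j ^ 2" "lip_norm f \<le> 2 * real j ^ b"
      using maj[of i j] ij by (meson less_imp_le)
    obtain g where g: "lipschitz_observable M g" "\<And>x. indicator (B j) x \<le> g x" "\<And>x. g x \<le> 1"
      "expectation g \<le> \<mu> j + 1 / real j ^ 2" "lip_norm g \<le> 2 * real j ^ b"
      using maj[of j j] ij by (meson less_imp_le order.trans order_refl)
    have [measurable]: "f \<in> borel_measurable M" "g \<in> borel_measurable M"
      using f g by (auto simp: lipschitz_observable_def)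
    have f0: "0 \<le> f x" for x using order.trans[OF _ f(2)[of x], of 0] by simp
    have g0: "0 \<le> g x" for x using order.trans[OF _ g(2)[of x], of 0] by simp
    have "expectation (\<lambda>x. hit i x * hit j x)
        = expectation (\<lambda>x. (\<lambda>y. indicator (B i) y * indicator (B j) ((T ^^ k) y)) ((T ^^ i) x))"
      unfolding hit_def k(2) by (simp add: funpow_add)
    also have "\<dots> = expectation (\<lambda>y. indicator (B i) y * indicator (B j) ((T ^^ k) y))"
      by (rule integral_comp_measure_preserving[OF preserving]) measurable
    also have "\<dots> \<le> expectation (\<lambda>y. f y * g ((T ^^ k) y))"
    proof (rule integral_mono)
      show "integrable M (\<lambda>y. indicator (B i) y * indicator (B j) ((T ^^ k) y) :: real)"
        by (rule integrable_const_bound[of _ 1], rule AE_I2) (auto split: split_indicator, measurable)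
      show "integrable M (\<lambda>y. f y * g ((T ^^ k) y))"
        by (rule integrable_const_bound[of _ 1])
          (use f0 g0 f(3) g(3) in \<open>auto simp: abs_mult intro!: mult_le_one\<close>)
      show "indicator (B i) y * indicator (B j) ((T ^^ k) y) \<le> f y * g ((T ^^ k) y)" for y
        by (intro mult_mono f g f0) simp
    qed
    also have "\<dots> \<le> expectation f * expectation g + rate k * lip_norm f * lip_norm g"
      using decay[OF f(1) g(1) k(1)] by linarith
    also have "expectation f * expectation g \<le> (\<mu> i + 1 / real j ^ 2) * (\<mu> j + 1 / real j ^ 2)"
      using f0 g0 f(4) g(4) by (intro mult_mono) (auto intro: Bochner_Integration.integral_nonneg)
    also have "\<dots> \<le> \<mu> i * \<mu> j + 3 / real j ^ 2"
    proof -
      define e where "e = 1 / real j ^ 2"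
      have e: "0 \<le> e" "e \<le> 1" unfolding e_def using j by auto
      have "\<mu> i * e \<le> 1 * e" "\<mu> j * e \<le> 1 * e" "e * e \<le> 1 * e"
        using e by (intro mult_right_mono; simp)+
      then have "(\<mu> i + e) * (\<mu> j + e) \<le> \<mu> i * \<mu> j + 3 * e"
        by (simp add: algebra_simps)
      then show ?thesis unfolding e_def by simp
    qed
    also have "rate k * lip_norm f * lip_norm g \<le> 4 * C / real j ^ 2"
    proof -
      have n: "0 \<le> lip_norm f" "0 \<le> lip_norm g"
        using lip_norm_nonneg f(1) g(1) by auto
      have "rate k * lip_norm f * lip_norm g \<le> (C * \<alpha> ^ k) * lip_norm f * lip_norm g"
        using rate[OF k(1)] n by (intro mult_right_mono)
      also have "\<dots> \<le> (C * (1 / real j ^ (2 * b + 2))) * (2 * real j ^ b) * (2 * real j ^ b)"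
        using \<alpha>_power_le[OF j(2), of k] far n f(5) g(5) C \<alpha> unfolding k_def
        by (intro mult_mono mult_left_mono mult_nonneg_nonneg) auto
      also have "\<dots> = 4 * C / real j ^ 2"
        using j by (simp add: power_add power_mult power2_eq_square divide_simps)
      finally show ?thesis .
    qed
    finally show "expectation (\<lambda>x. hit i x * hit j x) - \<mu> i * \<mu> j \<le> (3 + 4 * C) / real j ^ 2"
      by (simp add: add_divide_distrib)
  qed
qed

text \<open>Indices below N and those within \<kappa> ln j of j contribute at most \<mu> j each. The
  remaining ones, fewer than j, contribute O(j^(-2)) each, in total O(1/j), which is O(\<mu> j)
  because \<mu> j >= 1/j.\<close>

lemma sum_covariance_le:
  obtains A where "A \<ge> 0" and "\<And>j. j \<ge> 1 \<Longrightarrow>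
    (\<Sum>i=1..<j. expectation (\<lambda>x. hit i x * hit j x) - \<mu> i * \<mu> j) \<le> (A + \<kappa> * ln (real j)) * \<mu> j"
proof -
  obtain N where N: "N \<ge> 3" and cov: "\<And>i j. N \<le> i \<Longrightarrow> i < j \<Longrightarrow> \<kappa> * ln (real j) \<le> real (j - i) \<Longrightarrow>
    expectation (\<lambda>x. hit i x * hit j x) - \<mu> i * \<mu> j \<le> (3 + 4 * C) / real j ^ 2"
    using covariance_le by blast
  show thesis
  proof (rule that[of "real N + 3 + 4 * C"])
    show "real N + 3 + 4 * C \<ge> 0" using C by simp
    fix j :: nat assume j: "j \<ge> 1"
    let ?cov = "\<lambda>i. expectation (\<lambda>x. hit i x * hit j x) - \<mu> i * \<mu> j"
    have cov_le: "?cov i \<le> \<mu> j" for i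
      using expectation_hit_mult_le[of i j] by (smt (verit) measure_nonneg mult_nonneg_nonneg)
    have ln_j: "\<kappa> * ln (real j) \<ge> 0"
      using \<kappa>_nonneg j by simp
    show "(\<Sum>i=1..<j. ?cov i) \<le> (real N + 3 + 4 * C + \<kappa> * ln (real j)) * \<mu> j"
    proof (cases "j \<le> N")
      case True
      have "(\<Sum>i=1..<j. ?cov i) \<le> real (card {1..<j}) * \<mu> j"
        by (rule sum_bounded_above) (rule cov_le)
      also have "\<dots> \<le> (real N + 3 + 4 * C + \<kappa> * ln (real j)) * \<mu> j"
        using True C ln_j by (intro mult_right_mono) auto
      finally show ?thesis .
    next
      case False
      then have j3: "j \<ge> 3" using N by simp
      \<comment> \<open>The exceptional indices, too early or too near j. If the gap exceeds j,
        truncated subtraction gives 0 and every i < j counts as near.\<close>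
      define G where "G = {..<N} \<union> {j - nat \<lfloor>\<kappa> * ln (real j)\<rfloor>..<j}"
      have G: "finite G" "real (card G) \<le> real N + \<kappa> * ln (real j)"
      proof -
        show "finite G" unfolding G_def by simp
        have "card G \<le> card {..<N} + card {j - nat \<lfloor>\<kappa> * ln (real j)\<rfloor>..<j}"
          unfolding G_def by (rule card_Un_le)
        also have "\<dots> \<le> N + nat \<lfloor>\<kappa> * ln (real j)\<rfloor>" by simp
        finally have "real (card G) \<le> real N + real (nat \<lfloor>\<kappa> * ln (real j)\<rfloor>)"
          by (metis of_nat_add of_nat_mono)
        also have "real (nat \<lfloor>\<kappa> * ln (real j)\<rfloor>) \<le> \<kappa> * ln (real j)"
          using ln_j by simp
        finally show "real (card G) \<le> real N + \<kappa> * ln (real j)" by simp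
      qed
      have far: "?cov i \<le> (3 + 4 * C) / real j ^ 2" if "i \<in> {1..<j} - G" for i
      proof (rule cov)
        have i: "N \<le> i" "i < j" "i < j - nat \<lfloor>\<kappa> * ln (real j)\<rfloor>"
          using that unfolding G_def by auto
        then show "N \<le> i" "i < j" by auto
        have "nat \<lfloor>\<kappa> * ln (real j)\<rfloor> < j - i" using i by linarith
        then show "\<kappa> * ln (real j) \<le> real (j - i)" by linarith
      qed
      have "(\<Sum>i=1..<j. ?cov i) = (\<Sum>i\<in>{1..<j} \<inter> G. ?cov i) + (\<Sum>i\<in>{1..<j} - G. ?cov i)"
        by (rule sum.Int_Diff) simp
      also have "(\<Sum>i\<in>{1..<j} \<inter> G. ?cov i) \<le> real (card ({1..<j} \<inter> G)) * \<mu> j"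
        by (rule sum_bounded_above) (rule cov_le)
      also have "\<dots> \<le> (real N + \<kappa> * ln (real j)) * \<mu> j"
      proof (rule mult_right_mono)
        have "card ({1..<j} \<inter> G) \<le> card G"
          using G by (intro card_mono) auto
        then show "real (card ({1..<j} \<inter> G)) \<le> real N + \<kappa> * ln (real j)"
          using G by linarith
      qed simp
      also have "(\<Sum>i\<in>{1..<j} - G. ?cov i) \<le> real (card ({1..<j} - G)) * ((3 + 4 * C) / real j ^ 2)"
        by (rule sum_bounded_above) (rule far)
      also have "\<dots> \<le> real j * ((3 + 4 * C) / real j ^ 2)"
      proof (rule mult_right_mono)
        have "card ({1..<j} - G) \<le> card {1..<j}"
          by (intro card_mono) auto
        then show "real (card ({1..<j} - G)) \<le> real j" by simp
      qed (use C in simp)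
      also have "\<dots> = (3 + 4 * C) * (1 / real j)"
        using j by (simp add: power2_eq_square)
      also have "\<dots> \<le> (3 + 4 * C) * \<mu> j"
        using \<mu>_ge[OF j3] C by (intro mult_left_mono) auto
      finally show ?thesis
        by (simp add: algebra_simps)
    qed
  qed
qed

section \<open>Divergence of the expected hits and the strong law\<close>

lemma expected_hits_at_top: "filterlim (\<lambda>n. \<Sum>k=1..n. \<mu> k) at_top sequentially"
proof (rule filterlim_at_top_mono)
  show "filterlim (\<lambda>n. ((ln (real (Suc n)))\<^sup>2 - 4) / 3) at_top sequentially"
    by real_asymp
  show "eventually (\<lambda>n. ((ln (real (Suc n)))\<^sup>2 - 4) / 3 \<le> (\<Sum>k=1..n. \<mu> k)) sequentially"
    using square_ln_le_sum[of \<mu>, OF balls] by (auto simp: field_simps intro!: always_eventually)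
qed

text \<open>For j <= n the factor A + \<kappa> ln j is at most a constant times sqrt (E n), so the
  variance is O(E_n^(3/2)), exactly what the strong law takes as input.\<close>

theorem strong_borel_cantelli:
  "AE x in M. (\<lambda>n. (\<Sum>k=1..n. hit k x) / (\<Sum>k=1..n. \<mu> k)) \<longlonglongrightarrow> 1"
proof -
  obtain A where A: "A \<ge> 0" and cov: "\<And>j. j \<ge> 1 \<Longrightarrow>
    (\<Sum>i=1..<j. expectation (\<lambda>x. hit i x * hit j x) - \<mu> i * \<mu> j) \<le> (A + \<kappa> * ln (real j)) * \<mu> j"
    using sum_covariance_le by blast
  define E where "E n = (\<Sum>k=1..n. \<mu> k)" for n
  have var: "expectation (\<lambda>x. ((\<Sum>k=1..n. hit k x) - E n)\<^sup>2)
      \<le> (1 + 2 * (A + 4 * \<kappa>)) * (E n * sqrt (E n))" if E1: "E n \<ge> 1" for n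
  proof -
    have sqrt_E: "sqrt (E n) \<ge> 1" using E1 by simp
    \<comment> \<open>E n >= 1 absorbs the additive 4; any constant from 7 on would do, and 16 has
      an integer root. The bound at n + 1 covers every j <= n by monotonicity.\<close>
    have "ln (real (Suc n)) \<le> 4 * sqrt (E n)"
    proof (rule power2_le_imp_le)
      have "(ln (real (Suc n)))\<^sup>2 \<le> 3 * E n + 4"
        unfolding E_def using balls by (rule square_ln_le_sum)
      also have "\<dots> \<le> 16 * E n" using E1 by simp
      also have "\<dots> = (4 * sqrt (E n))\<^sup>2" using E1 by (simp add: power_mult_distrib)
      finally show "(ln (real (Suc n)))\<^sup>2 \<le> (4 * sqrt (E n))\<^sup>2" .
    qed (use E1 in simp)
    then have ln_j: "ln (real j) \<le> 4 * sqrt (E n)" if "j \<in> {1..n}" for j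
      using that by (smt (verit) atLeastAtMost_iff le_SucI ln_mono of_nat_0_less_iff of_nat_mono order_less_le_trans zero_less_one)
    have "expectation (\<lambda>x. ((\<Sum>k=1..n. hit k x) - E n)\<^sup>2)
        \<le> (\<Sum>j=1..n. (1 + 2 * (A + \<kappa> * ln (real j))) * \<mu> j)"
      using expectation_square_sum_le[of hit "\<lambda>j. A + \<kappa> * ln (real j)" n] hit_bounds cov
      unfolding E_def by (simp add: expectation_hit)
    also have "\<dots> \<le> (\<Sum>j=1..n. ((1 + 2 * (A + 4 * \<kappa>)) * sqrt (E n)) * \<mu> j)"
    proof (intro sum_mono mult_right_mono)
      fix j assume "j \<in> {1..n}"
      then have "\<kappa> * ln (real j) \<le> \<kappa> * (4 * sqrt (E n))"
        using \<kappa>_nonneg ln_j by (intro mult_left_mono) auto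
      moreover have "1 + 2 * A \<le> (1 + 2 * A) * sqrt (E n)"
        using mult_left_mono[OF sqrt_E, of "1 + 2 * A"] A by simp
      ultimately show "1 + 2 * (A + \<kappa> * ln (real j)) \<le> (1 + 2 * (A + 4 * \<kappa>)) * sqrt (E n)"
        by (simp add: algebra_simps)
    qed simp
    also have "\<dots> = (1 + 2 * (A + 4 * \<kappa>)) * (E n * sqrt (E n))"
      unfolding sum_distrib_left[symmetric] E_def[symmetric] by simp
    finally show ?thesis .
  qed
  show ?thesis
    using strong_law_of_variance_bound[of hit "1 + 2 * (A + 4 * \<kappa>)"] hit_bounds
      expected_hits_at_top var unfolding E_def by (simp add: expectation_hit)
qed

end

theorem theorem4p1:
  fixes M :: "'a::metric_space measure" and T :: "'a \<Rightarrow> 'a"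
    and rate :: "nat \<Rightarrow> real" and C \<alpha> r0 \<delta> :: real
    and p :: "nat \<Rightarrow> 'a" and r :: "nat \<Rightarrow> real"
  assumes prob: "prob_space M" and space: "space M = UNIV"
    and ball_sets: "\<And>z s. ball z s \<in> sets M"
    and ergodic: "ergodic M T"
    and C: "C > 0" and \<alpha>: "0 < \<alpha>" "\<alpha> < 1"
    and rate: "\<And>k. k \<ge> 1 \<Longrightarrow> rate k \<le> C * \<alpha> ^ k"
    and decay: "\<And>\<phi> \<psi> k. lipschitz_observable M \<phi> \<Longrightarrow> lipschitz_observable M \<psi> \<Longrightarrow> k \<ge> 1 \<Longrightarrow>
      \<bar>(\<integral>x. \<phi> x * \<psi> ((T ^^ k) x) \<partial>M) - (\<integral>x. \<phi> x \<partial>M) * (\<integral>x. \<psi> x \<partial>M)\<bar>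
        \<le> rate k * lip_norm \<phi> * lip_norm \<psi>"
    and r0: "r0 > 0" and \<delta>: "0 < \<delta>" "\<delta> < 1"
    and annulus: "\<And>z s \<epsilon>. 0 < \<epsilon> \<Longrightarrow> \<epsilon> < s \<Longrightarrow> s \<le> r0 \<Longrightarrow>
      measure M {x. s < dist x z \<and> dist x z < s + \<epsilon>} < \<epsilon> powr \<delta>"
    and radii: "\<forall>\<^sub>F i in sequentially. r i \<le> r0"
    and balls: "\<And>i. i \<ge> 1 \<Longrightarrow> measure M (ball (p i) (r i)) \<ge> ln (real i) / real i"
  shows "AE x in M.
    (\<lambda>n. (\<Sum>k=1..n. indicator (ball (p k) (r k)) ((T ^^ k) x)) /
         (\<Sum>k=1..n. measure M (ball (p k) (r k)))) \<longlonglongrightarrow> (1::real)"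
proof -
  interpret prob_space M by (rule prob)
  interpret shrinking_balls M T rate C \<alpha> r0 \<delta> p r
    by unfold_locales (use assms in \<open>auto simp: ergodic_def\<close>)
  show ?thesis
    using strong_borel_cantelli unfolding hit_def .
qed

end
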